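(* Let $f\in L^1(\mathbb{R}^N)$ with $\mathcal{Q}_{\boldsymbol{\Lambda}}f\in L^1(\mathbb{R}^N)$. Then for almost every $\boldsymbol{x}\in\mathbb{R}^N$, $$f(\boldsymbol{x})=\int_{\mathbb{R}^N}(\mathcal{Q}_{\boldsymbol{\Lambda}}f)(\boldsymbol{t})\,\mathcal{K}_{-\boldsymbol{\Lambda}}(\boldsymbol{t},\boldsymbol{x})\,d\boldsymbol{t},$$ i.e. $(\mathcal{Q}_{-\boldsymbol{\Lambda}}\circ\mathcal{Q}_{\boldsymbol{\Lambda}})(f)=f$.
   Context: Let $N\ge 1$ and $\boldsymbol{\Lambda}=(\Lambda_1,\dots,\Lambda_N)$ with $\Lambda_k=(a_k,b_k,c_k,d_k,e_k)\in\mathbb{R}^5$ and $b_k\neq 0$ for $k=1,\dots,N$. With principal square roots, for $\boldsymbol{\omega},\boldsymbol{x}\in\mathbb{R}^N$ put $$\mathcal{K}_{\boldsymbol{\Lambda}}(\boldsymbol{\omega},\boldsymbol{x})=\prod_{k=1}^N\sqrt{\tfrac{b_k}{2\pi i}}\;e^{i(a_kx_k^2+b_kx_k\omega_k+c_k\omega_k^2+d_kx_k+e_k\omega_k)},$$ $$\mathcal{K}_{-\boldsymbol{\Lambda}}(\boldsymbol{\omega},\boldsymbol{x})=\prod_{k=1}^N\sqrt{\tfrac{b_k i}{2\pi}}\;e^{-i(a_kx_k^2+b_kx_k\omega_k+c_k\omega_k^2+d_kx_k+e_k\omega_k)}.$$ For $f\in L^1(\mathbb{R}^N)$, $(\mathcal{Q}_{\boldsymbol{\Lambda}}f)(\boldsymbol{\omega})=\int_{\mathbb{R}^N}\mathcal{K}_{\boldsymbol{\Lambda}}(\boldsymbol{\omega},\boldsymbol{x})f(\boldsymbol{x})\,d\boldsymbol{x}$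 is the multidimensional QPFT, and for $F\in L^1(\mathbb{R}^N)$, $(\mathcal{Q}_{-\boldsymbol{\Lambda}}F)(\boldsymbol{x})=\int_{\mathbb{R}^N}\mathcal{K}_{-\boldsymbol{\Lambda}}(\boldsymbol{\omega},\boldsymbol{x})F(\boldsymbol{\omega})\,d\boldsymbol{\omega}$. *)

theory Defs
  imports "HOL-Analysis.Analysis"
begin

text \<open>
  The multidimensional quadratic-phase Fourier transform on \<open>real ^ 'n\<close>. A parameter quintuple
  \<open>(a\<^sub>k, b\<^sub>k, c\<^sub>k, d\<^sub>k, e\<^sub>k)\<close> is a record of five reals, and the whole parameter set is a family
  \<open>\<Lambda>\<close> of such records indexed by the coordinates. The space \<open>L\<^sup>1\<close> is that of the complete measure
  \<^const>\<open>lebesgue\<close>, so its elements need only be Lebesgue (not Borel) measurable.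
\<close>

record qpft_param =
  par_a :: real
  par_b :: real
  par_c :: real
  par_d :: real
  par_e :: real

definition qpft_phase :: "qpft_param \<Rightarrow> real \<Rightarrow> real \<Rightarrow> real" where
  "qpft_phase p w x =
     par_a p * x\<^sup>2 + par_b p * x * w + par_c p * w\<^sup>2 + par_d p * x + par_e p * w"

text \<open>\<^const>\<open>csqrt\<close> is the principal branch; its arguments below are purely imaginary and nonzero
  whenever \<open>b\<^sub>k \<noteq> 0\<close>, hence off the branch cut.\<close>

definition qpft_kernel ::
    "('n::finite \<Rightarrow> qpft_param) \<Rightarrow> real ^ 'n \<Rightarrow> real ^ 'n \<Rightarrow> complex" where
  "qpft_kernel \<Lambda> \<omega> x =
     (\<Prod>k\<in>UNIV. csqrt (complex_of_real (par_b (\<Lambda> k)) / (2 * complex_of_real pi * \<i>)) *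
        exp (\<i> * complex_of_real (qpft_phase (\<Lambda> k) (\<omega> $ k) (x $ k))))"

text \<open>The kernel written with index \<open>-\<Lambda>\<close>. It is a definition of its own: negating the parameters
  in \<open>qpft_kernel\<close> gives the same expression, but the defining formula is kept literally.\<close>

definition qpft_neg_kernel ::
    "('n::finite \<Rightarrow> qpft_param) \<Rightarrow> real ^ 'n \<Rightarrow> real ^ 'n \<Rightarrow> complex" where
  "qpft_neg_kernel \<Lambda> \<omega> x =
     (\<Prod>k\<in>UNIV. csqrt (complex_of_real (par_b (\<Lambda> k)) * \<i> / (2 * complex_of_real pi)) *
        exp (- \<i> * complex_of_real (qpft_phase (\<Lambda> k) (\<omega> $ k) (x $ k))))"

definition qpft ::
    "('n::finite \<Rightarrow> qpft_param) \<Rightarrow> (real ^ 'n \<Rightarrow> complex) \<Rightarrow> real ^ 'n \<Rightarrow> complex" where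
  "qpft \<Lambda> f \<omega> = (LINT x|lebesgue. qpft_kernel \<Lambda> \<omega> x * f x)"

definition qpft_neg ::
    "('n::finite \<Rightarrow> qpft_param) \<Rightarrow> (real ^ 'n \<Rightarrow> complex) \<Rightarrow> real ^ 'n \<Rightarrow> complex" where
  "qpft_neg \<Lambda> F x = (LINT \<omega>|lebesgue. qpft_neg_kernel \<Lambda> \<omega> x * F \<omega>)"

end

theory Submission
  imports Defs "HOL-Probability.Characteristic_Functions"
begin

text \<open>
  Since the phase is a quadratic polynomial whose only mixed terms are \<open>b\<^sub>k x\<^sub>k \<omega>\<^sub>k\<close>, the transform is the
  ordinary Fourier transform in disguise. Writing \<open>p\<close> and \<open>q\<close> for the parts of the phase that depend
  on \<open>x\<close> alone and on \<open>\<omega>\<close> alone, and \<open>D\<close> for the diagonal map \<open>\<omega> \<mapsto> (b\<^sub>k \<omega>\<^sub>k)\<^sub>k\<close>, one has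
  \<open>Q f \<omega> = C e\<^bsup>i q(\<omega>)\<^esup> \<F>(e\<^bsup>i p\<^esup> f) (D \<omega>)\<close>, which is \<open>qpft_eq_fourier\<close>. The chirps are unimodular and
  \<open>D\<close> is invertible because every \<open>b\<^sub>k\<close> is nonzero, so integrability of \<open>f\<close> and of \<open>Q f\<close> is
  integrability of \<open>g = e\<^bsup>i p\<^esup> f\<close> and of \<open>\<F> g\<close>. The inverse kernel carries the conjugate chirps, the
  substitution \<open>\<omega> = D t\<close> contributes the factor \<open>\<Prod> \<bar>b\<^sub>k\<bar>\<close>, and the two normalising constants multiply
  to \<open>\<Prod> \<bar>b\<^sub>k\<bar> / (2 \<pi>)\<close> (\<open>qpft_const_mult_neg_const\<close>). What remains is the Fourier inversion theorem
  for \<open>L\<^sup>1\<close> functions with \<open>L\<^sup>1\<close> transform on a Euclidean space.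

  That theorem, \<open>fourier_inversion\<close>, is obtained by Gaussian regularisation. A standard Gaussian is, up
  to a constant, its own Fourier transform, so Fubini's theorem turns the inversion integral damped by
  \<open>exp (- (norm (s \<omega>))\<^sup>2 / 2)\<close> into an average of \<open>g (x + s z)\<close> over a Gaussian variable \<open>z\<close>
  (\<open>gauss_regularised_inversion\<close>). Let \<open>s\<close> tend to \<open>0\<close>. The damped integrals converge pointwise and
  boundedly to the undamped one. The averages need not converge pointwise, but their integrals over a
  box do converge to the integral of \<open>g\<close>: after a translation only the indicator of the box moves, and
  it converges off the boundary, which is a null set (\<open>gauss_average_tendsto\<close>). Hence both sides of the
  inversion formula have equal integrals over all boxes and agree almost everywhere
  (\<open>AE_eq_0_if_box_integrals_eq_0\<close>).
\<close>

section \<open>Integration over coordinates and linear substitutions\<close>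

text \<open>
  Lebesgue measure on a Euclidean space is the image of the product measure on coordinates, so a
  product of functions of single coordinates integrates factor by factor. This reduces Gaussian
  integrals to dimension one.
\<close>

lemma has_bochner_integral_lborel_prod:
  fixes f :: "'a::euclidean_space \<Rightarrow> real \<Rightarrow> 'b::{real_normed_field, banach, second_countable_topology}"
  assumes int: "\<And>b. b \<in> Basis \<Longrightarrow> integrable lborel (f b)"
  shows "has_bochner_integral lborel (\<lambda>x. \<Prod>b\<in>Basis. f b (x \<bullet> b)) (\<Prod>b\<in>Basis. integral\<^sup>L lborel (f b))"
proof -
  interpret product_sigma_finite "\<lambda>b::'a. lborel :: real measure" ..
  have [measurable]: "\<And>b. b \<in> Basis \<Longrightarrow> f b \<in> borel_measurable borel"
    using int by (auto dest: borel_measurable_integrable)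
  have "integrable (\<Pi>\<^sub>M b\<in>Basis. lborel) (\<lambda>x. \<Prod>b\<in>Basis. f b (x b))"
    using int by (intro product_integrable_prod) auto
  moreover have "integral\<^sup>L (\<Pi>\<^sub>M b\<in>Basis. lborel) (\<lambda>x. \<Prod>b\<in>Basis. f b (x b)) = (\<Prod>b\<in>Basis. integral\<^sup>L lborel (f b))"
    using int by (intro product_integral_prod) auto
  ultimately show ?thesis
    unfolding has_bochner_integral_iff
    by (subst (1 2) lborel_eq) (simp add: integrable_distr_eq integral_distr)
qed

text \<open>
  The change of variables for the affine maps that scale each coordinate by its own nonzero factor;
  the uniform scaling below serves the regularisation, the general one the map
  \<open>\<omega> \<mapsto> (b\<^sub>k \<omega>\<^sub>k)\<^sub>k\<close>.
\<close>

lemma lborel_diagonal_affine: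
  fixes F :: "'a::euclidean_space \<Rightarrow> 'b::{banach, second_countable_topology}" and c :: "'a \<Rightarrow> real" and t :: 'a
  defines "T x \<equiv> t + (\<Sum>j\<in>Basis. (c j * (x \<bullet> j)) *\<^sub>R j)"
  assumes [measurable]: "F \<in> borel_measurable borel" and c: "\<And>j. j \<in> Basis \<Longrightarrow> c j \<noteq> 0"
  shows "integrable lborel (\<lambda>x. F (T x)) \<longleftrightarrow> integrable lborel F"
    and "integral\<^sup>L lborel F = (\<Prod>j\<in>Basis. \<bar>c j\<bar>) *\<^sub>R integral\<^sup>L lborel (\<lambda>x. F (T x))"
proof -
  have [measurable]: "T \<in> borel \<rightarrow>\<^sub>M borel"
    by (simp add: T_def[abs_def])
  have eq: "lborel = density (distr lborel borel T) (\<lambda>_. ennreal (\<Prod>j\<in>Basis. \<bar>c j\<bar>))"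
    using lborel_affine_euclidean[of c t, OF c] by (simp add: T_def[abs_def])
  have pos: "(\<Prod>j\<in>Basis. \<bar>c j\<bar>) \<noteq> 0" "(\<Prod>j\<in>Basis. \<bar>c j\<bar>) \<ge> 0"
    using c by (auto intro: prod_nonneg)
  show "integrable lborel (\<lambda>x. F (T x)) \<longleftrightarrow> integrable lborel F"
  proof -
    have "integrable lborel F \<longleftrightarrow> integrable lborel (\<lambda>x. (\<Prod>j\<in>Basis. \<bar>c j\<bar>) *\<^sub>R F (T x))"
      using pos(2) by (subst eq) (simp add: integrable_density integrable_distr_eq)
    also have "\<dots> \<longleftrightarrow> integrable lborel (\<lambda>x. F (T x))"
      using integrable_scaleR_right[of "1 / (\<Prod>j\<in>Basis. \<bar>c j\<bar>)" lborel "\<lambda>x. (\<Prod>j\<in>Basis. \<bar>c j\<bar>) *\<^sub>R F (T x)"] pos(1)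
      by (auto simp del: prod_zero_iff)
    finally show ?thesis ..
  qed
  show "integral\<^sup>L lborel F = (\<Prod>j\<in>Basis. \<bar>c j\<bar>) *\<^sub>R integral\<^sup>L lborel (\<lambda>x. F (T x))"
    using pos by (subst eq) (simp add: integral_density integral_distr)
qed

lemma lborel_homothety:
  fixes F :: "'a::euclidean_space \<Rightarrow> 'b::{banach, second_countable_topology}" and c :: real
  assumes "F \<in> borel_measurable borel" and "c \<noteq> 0"
  shows "integrable lborel (\<lambda>x. F (t + c *\<^sub>R x)) \<longleftrightarrow> integrable lborel F"
    and "integral\<^sup>L lborel F = \<bar>c\<bar> ^ DIM('a) *\<^sub>R integral\<^sup>L lborel (\<lambda>x. F (t + c *\<^sub>R x))"
proof -
  have T: "(\<Sum>j\<in>Basis. (c * (x \<bullet> j)) *\<^sub>R j) = c *\<^sub>R x" for x :: 'a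
    by (simp add: scaleR_scaleR[symmetric] scaleR_sum_right[symmetric] euclidean_representation del: scaleR_scaleR)
  show "integrable lborel (\<lambda>x. F (t + c *\<^sub>R x)) \<longleftrightarrow> integrable lborel F"
    and "integral\<^sup>L lborel F = \<bar>c\<bar> ^ DIM('a) *\<^sub>R integral\<^sup>L lborel (\<lambda>x. F (t + c *\<^sub>R x))"
    using lborel_diagonal_affine[of F "\<lambda>_. c" t] assms by (auto simp: T)
qed

lemma bij_betw_axis_Basis: "bij_betw (\<lambda>k. axis k 1) UNIV (Basis :: (real ^ 'n) set)"
  by (auto simp: bij_betw_def inj_on_def axis_eq_axis Basis_vec_def)

lemma lborel_diagonal_vec:
  fixes F :: "real ^ 'n \<Rightarrow> 'b::{banach, second_countable_topology}" and b :: "'n \<Rightarrow> real"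
  assumes F: "F \<in> borel_measurable borel" and b: "\<And>k. b k \<noteq> 0"
  shows "integrable lborel (\<lambda>\<omega>. F (\<chi> k. b k * \<omega> $ k)) \<longleftrightarrow> integrable lborel F"
    and "integral\<^sup>L lborel F = (\<Prod>k\<in>UNIV. \<bar>b k\<bar>) *\<^sub>R (LINT \<omega>|lborel. F (\<chi> k. b k * \<omega> $ k))"
proof -
  define c where "c j = (\<chi> k. b k) \<bullet> j" for j
  have c_axis: "c (axis k 1) = b k" for k
    by (simp add: c_def inner_axis)
  have c: "c j \<noteq> 0" if "j \<in> Basis" for j
    using that b c_axis by (auto simp: Basis_vec_def)
  have T: "0 + (\<Sum>j\<in>Basis. (c j * (\<omega> \<bullet> j)) *\<^sub>R j) = (\<chi> k. b k * \<omega> $ k)" for \<omega> :: "real ^ 'n"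
  proof (rule euclidean_eqI)
    fix j :: "real ^ 'n" assume j: "j \<in> Basis"
    then obtain k where "j = axis k 1"
      by (auto simp: Basis_vec_def)
    have "(0 + (\<Sum>j\<in>Basis. (c j * (\<omega> \<bullet> j)) *\<^sub>R j)) \<bullet> j = c j * (\<omega> \<bullet> j)"
      using j by (simp only: add_0_left inner_sum_left_Basis)
    then show "(0 + (\<Sum>j\<in>Basis. (c j * (\<omega> \<bullet> j)) *\<^sub>R j)) \<bullet> j = (\<chi> k. b k * \<omega> $ k) \<bullet> j"
      by (simp only: \<open>j = axis k 1\<close> c_axis) (simp add: inner_axis)
  qed
  have "(\<Prod>j\<in>Basis. \<bar>c j\<bar>) = (\<Prod>k\<in>UNIV. \<bar>b k\<bar>)"
    by (subst prod.reindex_bij_betw[OF bij_betw_axis_Basis, symmetric]) (simp add: c_axis)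
  then show "integrable lborel (\<lambda>\<omega>. F (\<chi> k. b k * \<omega> $ k)) \<longleftrightarrow> integrable lborel F"
    and "integral\<^sup>L lborel F = (\<Prod>k\<in>UNIV. \<bar>b k\<bar>) *\<^sub>R (LINT \<omega>|lborel. F (\<chi> k. b k * \<omega> $ k))"
    using lborel_diagonal_affine[of F c 0, OF F c] unfolding T by auto
qed

lemma vec_lambda_scale_measurable [measurable]:
  "(\<lambda>\<omega>. (\<chi> k. b k * \<omega> $ k) :: real ^ 'n) \<in> borel_measurable borel"
  by (intro borel_measurable_continuous_onI continuous_intros)

section \<open>The Gaussian and its Fourier transform\<close>

definition gauss :: "'a::euclidean_space \<Rightarrow> real" where
  "gauss x = (\<Prod>b\<in>Basis. std_normal_density (x \<bullet> b))"

text \<open>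
  The rotation-invariant form of the density. It is stated with the exponential on the left because it
  is used to turn a Gaussian damping factor into a density that can be integrated.
\<close>

lemma gauss_eq: "exp (- (norm x)\<^sup>2 / 2) = sqrt (2 * pi) ^ DIM('a) * gauss (x::'a::euclidean_space)"
proof -
  have "gauss x = (\<Prod>b\<in>(Basis::'a set). 1 / sqrt (2 * pi)) * (\<Prod>b\<in>Basis. exp (- (x \<bullet> b)\<^sup>2 / 2))"
    by (simp only: gauss_def std_normal_density_def prod.distrib)
  also have "(\<Prod>b\<in>Basis. exp (- (x \<bullet> b)\<^sup>2 / 2)) = exp (- (norm x)\<^sup>2 / 2)"
    unfolding exp_sum[OF finite_Basis, symmetric]
    by (simp add: norm_eq_sqrt_inner euclidean_inner[of x x] power2_eq_square sum_nonneg sum_negf sum_divide_distrib)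
  finally show ?thesis
    by (simp add: power_divide)
qed

lemma gauss_nonneg [simp]: "0 \<le> gauss x"
  by (simp add: gauss_def prod_nonneg)

lemma gauss_measurable [measurable]: "gauss \<in> borel_measurable borel"
  unfolding gauss_def[abs_def] by measurable

lemma has_bochner_integral_gauss:
  "has_bochner_integral lborel (gauss :: 'a::euclidean_space \<Rightarrow> real) 1"
proof -
  have "integrable lborel std_normal_density" "integral\<^sup>L lborel std_normal_density = 1"
    by simp_all
  then show ?thesis
    using has_bochner_integral_lborel_prod[of "\<lambda>_::'a. std_normal_density"]
    by (simp add: gauss_def[abs_def])
qed

lemma integrable_gauss [simp]: "integrable lborel gauss"
  and integral_gauss [simp]: "integral\<^sup>L lborel gauss = 1"
  using has_bochner_integral_gauss by (auto simp: has_bochner_integral_iff)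

text \<open>
  The Gaussian is an eigenfunction of the Fourier transform: both the character and the density factor
  over the coordinates, and in dimension one the claim is the formula for the characteristic function of
  the standard normal distribution.
\<close>

lemma gauss_fourier:
  fixes t :: "'a::euclidean_space"
  shows "(LINT z|lborel. iexp (t \<bullet> z) * complex_of_real (gauss z)) =
    complex_of_real (sqrt (2 * pi) ^ DIM('a) * gauss t)"
proof -
  have one: "(LINT u|lborel. iexp (r * u) * complex_of_real (std_normal_density u)) = complex_of_real (exp (- r\<^sup>2 / 2))" for r :: real
    using fun_cong[OF char_std_normal_distribution, of r]
    unfolding char_def by (subst (asm) integral_density) (auto simp: scaleR_conv_of_real mult.commute)
  have int: "integrable lborel (\<lambda>u. iexp (r * u) * complex_of_real (std_normal_density u))" for r :: real
    by (rule Bochner_Integration.integrable_bound[where f=std_normal_density]) (auto simp: norm_mult)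
  have "(LINT z|lborel. iexp (t \<bullet> z) * complex_of_real (gauss z)) =
     (LINT z|lborel. (\<Prod>b\<in>Basis. iexp ((t \<bullet> b) * (z \<bullet> b)) * complex_of_real (std_normal_density (z \<bullet> b))))"
  proof (rule Bochner_Integration.integral_cong)
    fix z :: 'a
    have "iexp (t \<bullet> z) = (\<Prod>b\<in>Basis. iexp ((t \<bullet> b) * (z \<bullet> b)))"
      by (simp only: euclidean_inner[of t z] exp_sum[OF finite_Basis, symmetric] of_real_sum sum_distrib_left)
    then show "iexp (t \<bullet> z) * complex_of_real (gauss z) =
        (\<Prod>b\<in>Basis. iexp ((t \<bullet> b) * (z \<bullet> b)) * complex_of_real (std_normal_density (z \<bullet> b)))"
      by (simp only: gauss_def prod.distrib of_real_prod)
  qed simp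
  also have "\<dots> = (\<Prod>b\<in>Basis. complex_of_real (exp (- (t \<bullet> b)\<^sup>2 / 2)))"
    using has_bochner_integral_lborel_prod[of "\<lambda>b u. iexp ((t \<bullet> b) * u) * complex_of_real (std_normal_density u)", OF int]
    unfolding one by (rule has_bochner_integral_integral_eq)
  also have "\<dots> = complex_of_real (exp (- (norm t)\<^sup>2 / 2))"
    unfolding of_real_prod[symmetric] exp_sum[OF finite_Basis, symmetric]
    by (simp add: norm_eq_sqrt_inner euclidean_inner[of t t] power2_eq_square sum_nonneg sum_negf sum_divide_distrib)
  finally show ?thesis by (simp only: gauss_eq)
qed

section \<open>The Gaussian-regularised inversion integral\<close>

text \<open>
  The sign of the exponent and the missing normalisation are those for which the phase of the
  quadratic-phase kernel appears directly, so the inversion formula below has the factor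
  \<open>(2 \<pi>)\<^bsup>dim\<^esup>\<close>.
\<close>

definition fourier :: "('a::euclidean_space \<Rightarrow> complex) \<Rightarrow> 'a \<Rightarrow> complex" where
  "fourier g \<omega> = (LINT y|lborel. iexp (\<omega> \<bullet> y) * g y)"

lemma fourier_measurable [measurable]:
  assumes [measurable]: "g \<in> borel_measurable borel"
  shows "fourier g \<in> borel_measurable borel"
  unfolding fourier_def[abs_def] by measurable

lemma gauss_fourier_scaled:
  fixes v :: "'a::euclidean_space"
  assumes s: "0 < s"
  shows "(LINT \<omega>|lborel. iexp (\<omega> \<bullet> v) * complex_of_real (gauss (s *\<^sub>R \<omega>))) =
    complex_of_real (sqrt (2 * pi) ^ DIM('a) / s ^ DIM('a) * gauss (v /\<^sub>R s))"
proof -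
  let ?F = "\<lambda>z. iexp ((v /\<^sub>R s) \<bullet> z) * complex_of_real (gauss z)"
  have "integral\<^sup>L lborel ?F = s ^ DIM('a) *\<^sub>R (LINT \<omega>|lborel. ?F (0 + s *\<^sub>R \<omega>))"
    using s by (subst lborel_homothety(2)[of ?F s 0]) auto
  moreover have "?F (0 + s *\<^sub>R \<omega>) = iexp (\<omega> \<bullet> v) * complex_of_real (gauss (s *\<^sub>R \<omega>))" for \<omega>
  proof -
    have "(v /\<^sub>R s) \<bullet> (s *\<^sub>R \<omega>) = \<omega> \<bullet> v"
      using s by (simp add: inner_commute)
    then show ?thesis by (simp only: add_0_left)
  qed
  ultimately have eq: "complex_of_real (sqrt (2 * pi) ^ DIM('a) * gauss (v /\<^sub>R s)) =
      s ^ DIM('a) *\<^sub>R (LINT \<omega>|lborel. iexp (\<omega> \<bullet> v) * complex_of_real (gauss (s *\<^sub>R \<omega>)))"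
    by (simp only: gauss_fourier)
  have solve: "complex_of_real A = c *\<^sub>R I \<Longrightarrow> c \<noteq> 0 \<Longrightarrow> I = complex_of_real (A / c)" for A c I
    by (simp add: scaleR_conv_of_real)
  show ?thesis
    unfolding times_divide_eq_left using s by (intro solve[OF eq]) simp
qed

lemma integrable_gauss_scaled:
  fixes s :: real
  assumes "s \<noteq> 0"
  shows "integrable lborel (\<lambda>\<omega>::'a::euclidean_space. gauss (s *\<^sub>R \<omega>))"
  using lborel_homothety(1)[of "gauss :: 'a \<Rightarrow> real" s 0] assms by simp

text \<open>
  Damping the inversion integral by a Gaussian makes the double integral over \<open>\<omega>\<close> and \<open>y\<close> absolutely
  convergent, so the order of integration can be exchanged. The integral over \<open>\<omega>\<close> is then the Fourier
  transform of a Gaussian of width \<open>1 / s\<close>, that is, a Gaussian of width \<open>s\<close> centred at \<open>x\<close>, and the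
  substitution \<open>y = x + s z\<close> normalises it. The constant arises as the product of two factors
  \<open>sqrt (2 \<pi>)\<^bsup>dim\<^esup>\<close>, one from the damping and one from the transform.
\<close>

lemma gauss_regularised_inversion:
  fixes g :: "'a::euclidean_space \<Rightarrow> complex"
  assumes g: "integrable lborel g" and s: "0 < s"
  shows "(LINT \<omega>|lborel. iexp (- (\<omega> \<bullet> x)) * (complex_of_real (exp (- (norm (s *\<^sub>R \<omega>))\<^sup>2 / 2)) * fourier g \<omega>)) =
    (2 * pi) ^ DIM('a) * (LINT z|lborel. complex_of_real (gauss z) * g (x + s *\<^sub>R z))"
proof -
  have [measurable]: "g \<in> borel_measurable borel"
    using g by (auto dest: borel_measurable_integrable)
  define K where "K = sqrt (2 * pi) ^ DIM('a)"
  have K: "K > 0" "K * K = (2 * pi) ^ DIM('a)"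
    unfolding K_def power_mult_distrib[symmetric] by auto
  define P where "P \<omega> y = iexp (\<omega> \<bullet> (y - x)) * (complex_of_real (K * gauss (s *\<^sub>R \<omega>)) * g y)" for \<omega> y
  have P_int: "integrable (lborel \<Otimes>\<^sub>M lborel) (case_prod P)"
  proof (rule lborel_pair.Fubini_integrable)
    show "case_prod P \<in> borel_measurable (lborel \<Otimes>\<^sub>M lborel)"
      unfolding P_def[abs_def] by measurable
    have "(\<integral>y. norm (case_prod P (\<omega>, y)) \<partial>lborel) = K * gauss (s *\<^sub>R \<omega>) * (\<integral>y. norm (g y) \<partial>lborel)" for \<omega>
      using K(1) by (simp add: P_def norm_mult mult.assoc)
    then show "integrable lborel (\<lambda>\<omega>. \<integral>y. norm (case_prod P (\<omega>, y)) \<partial>lborel)"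
      using s by (simp add: integrable_gauss_scaled)
    show "AE \<omega> in lborel. integrable lborel (\<lambda>y. case_prod P (\<omega>, y))"
    proof (rule AE_I2)
      fix \<omega>
      show "integrable lborel (\<lambda>y. case_prod P (\<omega>, y))"
        by (rule Bochner_Integration.integrable_bound[where f="\<lambda>y. (K * gauss (s *\<^sub>R \<omega>)) *\<^sub>R g y"])
          (use g K(1) in \<open>auto simp: P_def norm_mult\<close>)
    qed
  qed
  have "(LINT \<omega>|lborel. iexp (- (\<omega> \<bullet> x)) * (complex_of_real (exp (- (norm (s *\<^sub>R \<omega>))\<^sup>2 / 2)) * fourier g \<omega>)) =
      (LINT \<omega>|lborel. LINT y|lborel. P \<omega> y)"
  proof (rule Bochner_Integration.integral_cong)
    fix \<omega> :: 'a
    have "(LINT y|lborel. P \<omega> y) = (LINT y|lborel. (iexp (- (\<omega> \<bullet> x)) * complex_of_real (K * gauss (s *\<^sub>R \<omega>))) * (iexp (\<omega> \<bullet> y) * g y))"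
      unfolding P_def by (intro Bochner_Integration.integral_cong)
        (simp_all add: inner_diff_right right_diff_distrib exp_diff exp_minus field_simps)
    then show "iexp (- (\<omega> \<bullet> x)) * (complex_of_real (exp (- (norm (s *\<^sub>R \<omega>))\<^sup>2 / 2)) * fourier g \<omega>) = (LINT y|lborel. P \<omega> y)"
      by (simp only: integral_mult_right_zero fourier_def gauss_eq K_def mult.assoc)
  qed simp
  also have "\<dots> = (LINT y|lborel. LINT \<omega>|lborel. P \<omega> y)"
    by (rule lborel_pair.Fubini_integral[symmetric]) (rule P_int)
  also have "\<dots> = (LINT y|lborel. complex_of_real (K * K / s ^ DIM('a) * gauss ((y - x) /\<^sub>R s)) * g y)"
  proof (rule Bochner_Integration.integral_cong)
    fix y :: 'a
    have "(LINT \<omega>|lborel. P \<omega> y) = (LINT \<omega>|lborel. (complex_of_real K * g y) * (iexp (\<omega> \<bullet> (y - x)) * complex_of_real (gauss (s *\<^sub>R \<omega>))))"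
      unfolding P_def by (intro Bochner_Integration.integral_cong) (simp_all add: mult_ac)
    also have "\<dots> = (complex_of_real K * g y) * complex_of_real (K / s ^ DIM('a) * gauss ((y - x) /\<^sub>R s))"
      unfolding K_def by (simp only: integral_mult_right_zero gauss_fourier_scaled[OF s])
    finally show "(LINT \<omega>|lborel. P \<omega> y) = complex_of_real (K * K / s ^ DIM('a) * gauss ((y - x) /\<^sub>R s)) * g y"
      by simp
  qed simp
  also have "\<dots> = s ^ DIM('a) *\<^sub>R (LINT z|lborel. complex_of_real (K * K / s ^ DIM('a) * gauss z) * g (x + s *\<^sub>R z))"
    using s by (subst lborel_homothety(2)[where c=s and t=x]) auto
  also have "\<dots> = s ^ DIM('a) *\<^sub>R (LINT z|lborel. complex_of_real (K * K / s ^ DIM('a)) * (complex_of_real (gauss z) * g (x + s *\<^sub>R z)))"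
    by (simp only: of_real_mult mult.assoc)
  also have "\<dots> = complex_of_real (K * K) * (LINT z|lborel. complex_of_real (gauss z) * g (x + s *\<^sub>R z))"
    unfolding integral_mult_right_zero using s by (simp add: scaleR_conv_of_real)
  finally show ?thesis
    unfolding K(2) by simp
qed

section \<open>Convergence of Gaussian averages\<close>

lemma tendsto_indicator_off_frontier:
  assumes "X \<longlonglongrightarrow> y" "y \<notin> frontier A"
  shows "(\<lambda>n. indicator A (X n) :: real) \<longlonglongrightarrow> indicator A y"
proof (cases "y \<in> A")
  case True
  with assms(2) have "y \<in> interior A"
    by (metis DiffI closure_subset frontier_def subsetD)
  then have "eventually (\<lambda>n. X n \<in> interior A) sequentially"
    using assms(1) by (intro topological_tendstoD) auto
  then show ?thesis
    using True interior_subset[of A] by (intro tendsto_eventually) (auto elim!: eventually_mono)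
next
  case False
  with assms(2) have "y \<in> - closure A"
    by (metis ComplI DiffI frontier_def interior_subset subsetD)
  then have "eventually (\<lambda>n. X n \<in> - closure A) sequentially"
    using assms(1) by (intro topological_tendstoD) auto
  then show ?thesis
    using False closure_subset[of A] by (intro tendsto_eventually) (auto elim!: eventually_mono simp: indicator_def)
qed

text \<open>
  Translating the variable moves the shift from \<open>g\<close> to the indicator function, which converges
  pointwise off the null set \<open>frontier A\<close>; then \<open>\<bar>g\<bar>\<close> dominates.
\<close>

lemma tendsto_integral_translates:
  fixes g :: "'a::euclidean_space \<Rightarrow> complex"
  assumes g: "integrable lborel g" and [measurable]: "A \<in> sets borel" and fr: "negligible (frontier A)"
    and v: "v \<longlonglongrightarrow> 0"
  shows "(\<lambda>n. LINT x:A|lborel. g (x + v n)) \<longlonglongrightarrow> (LINT x:A|lborel. g x)"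
proof -
  have [measurable]: "g \<in> borel_measurable borel"
    using g by (auto dest: borel_measurable_integrable)
  have "(LINT x:A|lborel. g (x + v n)) = (LINT y|lborel. indicator A (y - v n) *\<^sub>R g y)" for n
    using lborel_homothety(2)[of "\<lambda>y. indicator A (y - v n) *\<^sub>R g y" 1 "v n"]
    by (simp add: set_lebesgue_integral_def add.commute)
  moreover have "(\<lambda>n. LINT y|lborel. indicator A (y - v n) *\<^sub>R g y) \<longlonglongrightarrow> (LINT y|lborel. indicator A y *\<^sub>R g y)"
  proof (rule integral_dominated_convergence[where w="\<lambda>y. cmod (g y)"])
    have "AE y in lebesgue. y \<notin> frontier A"
      using fr by (intro AE_not_in) (simp add: negligible_iff_null_sets)
    then have "AE y in lborel. y \<notin> frontier A"
      by (simp only: AE_completion_iff)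
    then show "AE y in lborel. (\<lambda>n. indicator A (y - v n) *\<^sub>R g y) \<longlonglongrightarrow> indicator A y *\<^sub>R g y"
    proof eventually_elim
      case (elim y)
      have "(\<lambda>n. y - v n) \<longlonglongrightarrow> y"
        using tendsto_diff[OF tendsto_const v, of y] by simp
      from tendsto_indicator_off_frontier[OF this elim] show ?case
        by (intro tendsto_intros)
    qed
  qed (use g in \<open>auto split: split_indicator\<close>)
  ultimately show ?thesis
    by (simp add: set_lebesgue_integral_def)
qed

text \<open>
  The bound is uniform in the shift \<open>v\<close>, which makes the Gaussian averages of these integrals amenable
  to dominated convergence.
\<close>

lemma set_integral_translate_bound:
  fixes g :: "'a::euclidean_space \<Rightarrow> complex"
  assumes g: "integrable lborel g" and [measurable]: "A \<in> sets borel"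
  shows "cmod (LINT x:A|lborel. g (x + v)) \<le> (LINT x|lborel. cmod (g x))"
proof -
  have [measurable]: "g \<in> borel_measurable borel"
    using g by (auto dest: borel_measurable_integrable)
  have int: "integrable lborel (\<lambda>x. g (x + v))"
    using lborel_homothety(1)[of g 1 v] g by (simp add: add.commute)
  have "cmod (LINT x:A|lborel. g (x + v)) \<le> (LINT x|lborel. cmod (indicator A x *\<^sub>R g (x + v)))"
    unfolding set_lebesgue_integral_def by (rule integral_norm_bound)
  also have "\<dots> \<le> (LINT x|lborel. cmod (g (x + v)))"
    using int by (intro integral_mono integrable_norm integrable_mult_indicator) (auto split: split_indicator)
  also have "\<dots> = (LINT x|lborel. cmod (g x))"
    using lborel_homothety(2)[of "\<lambda>x. cmod (g x)" 1 v] by (simp add: add.commute)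
  finally show ?thesis .
qed

lemma gauss_average_swap:
  fixes g :: "'a::euclidean_space \<Rightarrow> complex"
  assumes g: "integrable lborel g" and [measurable]: "A \<in> sets borel"
  shows "(LINT x:A|lborel. LINT z|lborel. complex_of_real (gauss z) * g (x + s *\<^sub>R z)) =
    (LINT z|lborel. complex_of_real (gauss z) * (LINT x:A|lborel. g (x + s *\<^sub>R z)))"
proof -
  have [measurable]: "g \<in> borel_measurable borel"
    using g by (auto dest: borel_measurable_integrable)
  define Q where "Q z x = complex_of_real (gauss z) * g (x + s *\<^sub>R z)" for z x
  have "integrable (lborel \<Otimes>\<^sub>M lborel) (case_prod Q)"
  proof (rule lborel_pair.Fubini_integrable)
    show "case_prod Q \<in> borel_measurable (lborel \<Otimes>\<^sub>M lborel)"
      unfolding Q_def[abs_def] by measurable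
    have "(LINT x|lborel. norm (case_prod Q (z, x))) = gauss z * (LINT x|lborel. norm (g x))" for z
      using lborel_homothety(2)[of "\<lambda>x. cmod (g x)" 1 "s *\<^sub>R z"]
      by (simp add: Q_def norm_mult add.commute)
    then show "integrable lborel (\<lambda>z. LINT x|lborel. norm (case_prod Q (z, x)))"
      by simp
    show "AE z in lborel. integrable lborel (\<lambda>x. case_prod Q (z, x))"
    proof (rule AE_I2)
      fix z
      have "integrable lborel (\<lambda>x. g (x + s *\<^sub>R z))"
        using lborel_homothety(1)[of g 1 "s *\<^sub>R z"] g by (simp add: add.commute)
      then show "integrable lborel (\<lambda>x. case_prod Q (z, x))"
        by (simp add: Q_def)
    qed
  qed
  then have "integrable (lborel \<Otimes>\<^sub>M lborel) (\<lambda>(z, x). indicator A x *\<^sub>R Q z x)"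
    by (rule Bochner_Integration.integrable_bound) (auto simp: Q_def split: split_indicator)
  from lborel_pair.Fubini_integral[OF this]
  have "(LINT x:A|lborel. LINT z|lborel. Q z x) = (LINT z|lborel. LINT x|lborel. indicator A x *\<^sub>R Q z x)"
    by (simp add: set_lebesgue_integral_def)
  also have "\<dots> = (LINT z|lborel. LINT x|lborel. complex_of_real (gauss z) * (indicator A x *\<^sub>R g (x + s *\<^sub>R z)))"
    by (simp only: Q_def mult_scaleR_right)
  finally show ?thesis
    by (simp only: Q_def set_lebesgue_integral_def integral_mult_right_zero)
qed

text \<open>
  With the average outermost, the claim for a fixed \<open>z\<close> is the convergence under translations by
  \<open>s n *\<^sub>R z\<close>; dominated convergence integrates it against the probability density \<open>gauss\<close>.
\<close>

lemma gauss_average_tendsto: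
  fixes g :: "'a::euclidean_space \<Rightarrow> complex"
  assumes g: "integrable lborel g" and A[measurable]: "A \<in> sets borel" and fr: "negligible (frontier A)"
    and s: "s \<longlonglongrightarrow> 0"
  shows "(\<lambda>n. LINT x:A|lborel. LINT z|lborel. complex_of_real (gauss z) * g (x + s n *\<^sub>R z)) \<longlonglongrightarrow>
    (LINT x:A|lborel. g x)"
proof -
  have [measurable]: "g \<in> borel_measurable borel"
    using g by (auto dest: borel_measurable_integrable)
  have "(\<lambda>n. LINT z|lborel. complex_of_real (gauss z) * (LINT x:A|lborel. g (x + s n *\<^sub>R z))) \<longlonglongrightarrow>
      (LINT z::'a|lborel. complex_of_real (gauss z) * (LINT x:A|lborel. g x))"
  proof (rule integral_dominated_convergence[where w="\<lambda>z::'a. gauss z * (LINT x|lborel. cmod (g x))"])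
    show "(\<lambda>z. complex_of_real (gauss z) * (LINT x:A|lborel. g (x + s n *\<^sub>R z))) \<in> borel_measurable lborel" for n
      unfolding set_lebesgue_integral_def by measurable
    show "AE z in lborel. (\<lambda>n. complex_of_real (gauss z) * (LINT x:A|lborel. g (x + s n *\<^sub>R z)))
        \<longlonglongrightarrow> complex_of_real (gauss z) * (LINT x:A|lborel. g x)"
    proof (rule AE_I2)
      fix z :: 'a
      have "(\<lambda>n. s n *\<^sub>R z) \<longlonglongrightarrow> 0"
        using tendsto_scaleR[OF s tendsto_const, of z] by simp
      then show "(\<lambda>n. complex_of_real (gauss z) * (LINT x:A|lborel. g (x + s n *\<^sub>R z)))
        \<longlonglongrightarrow> complex_of_real (gauss z) * (LINT x:A|lborel. g x)"
        by (intro tendsto_intros tendsto_integral_translates g A fr)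
    qed
    show "AE z in lborel. cmod (complex_of_real (gauss z) * (LINT x:A|lborel. g (x + s n *\<^sub>R z)))
        \<le> gauss z * (LINT x|lborel. cmod (g x))" for n
      using set_integral_translate_bound[OF g A] by (intro AE_I2) (simp add: norm_mult mult_left_mono)
  qed simp_all
  moreover have "(LINT z::'a|lborel. complex_of_real (gauss z) * (LINT x:A|lborel. g x)) = (LINT x:A|lborel. g x)"
    by (simp add: integral_gauss)
  ultimately show ?thesis
    by (simp add: gauss_average_swap[OF g A])
qed

section \<open>The Fourier inversion theorem\<close>

text \<open>
  Boxes are closed under intersection and generate the Borel sets. Cutting \<open>u\<close> off to a fixed box makes
  it integrable, and then the Borel sets over which its integral vanishes form a Dynkin system, so they
  are all Borel sets.
\<close>

lemma AE_eq_0_if_box_integrals_eq_0: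
  fixes u :: "'a::euclidean_space \<Rightarrow> 'b::{second_countable_topology, banach}"
  assumes int: "\<And>a b. set_integrable lborel (box a b) u"
    and zero: "\<And>a b. set_lebesgue_integral lborel (box a b) u = 0"
  shows "AE x in lborel. u x = 0"
proof -
  let ?B = "\<lambda>n::nat. box (- (real n *\<^sub>R One)) (real n *\<^sub>R One) :: 'a set"
  have "AE x in lborel. indicator (?B n) x *\<^sub>R u x = 0" for n
  proof (rule sigma_finite_measure.density_zero[OF sigma_finite_lborel])
    let ?u = "\<lambda>x. indicator (?B n) x *\<^sub>R u x"
    show u: "integrable lborel ?u"
      using int[of "- (real n *\<^sub>R One)" "real n *\<^sub>R One"] by (simp add: set_integrable_def)
    have su: "set_integrable lborel A ?u" if "A \<in> sets borel" for A
      unfolding set_integrable_def using u that by (intro integrable_mult_indicator[OF _ u]) auto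
    fix A :: "'a set" assume "A \<in> sets lborel"
    then have A: "A \<in> sigma_sets UNIV (range (\<lambda>(a, b). box a b))"
      by (simp add: borel_eq_box)
    have "Int_stable (range (\<lambda>(a, b). box a b :: 'a set))"
      by (auto simp: Int_stable_def box_Int_box)
    moreover have "range (\<lambda>(a, b). box a b :: 'a set) \<subseteq> Pow UNIV"
      by auto
    ultimately show "set_lebesgue_integral lborel A ?u = 0"
      using A
    proof (induction rule: sigma_sets_induct_disjoint)
      case (basic A)
      then obtain a b where "A \<inter> ?B n = box a b"
        by (auto simp: box_Int_box)
      then have "indicator A x *\<^sub>R ?u x = indicator (box a b) x *\<^sub>R u x" for x
        by (metis indicator_inter_arith scaleR_scaleR)
      then show ?case
        using zero[of a b] by (simp only: set_lebesgue_integral_def)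
    next
      case empty
      then show ?case by (simp add: set_lebesgue_integral_def)
    next
      case (compl A)
      then have [measurable]: "A \<in> sets borel"
        by (simp add: borel_eq_box)
      have "indicator (UNIV - A) x *\<^sub>R ?u x = ?u x - indicator A x *\<^sub>R ?u x" for x
        by (auto split: split_indicator)
      then have "set_lebesgue_integral lborel (UNIV - A) ?u = integral\<^sup>L lborel ?u - set_lebesgue_integral lborel A ?u"
        unfolding set_lebesgue_integral_def using u su[of A]
        by (simp add: set_integrable_def Bochner_Integration.integral_diff)
      then show ?case
        using zero[of "- (real n *\<^sub>R One)" "real n *\<^sub>R One"] compl.IH by (simp add: set_lebesgue_integral_def)
    next
      case (union A)
      then have [measurable]: "A i \<in> sets borel" for i
        by (auto simp: borel_eq_box subset_eq)
      have "set_lebesgue_integral lborel (\<Union>i. A i) ?u = (\<Sum>i. set_lebesgue_integral lborel (A i) ?u)"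
        using union(1) by (intro lebesgue_integral_countable_add su) (auto simp: disjoint_family_on_def)
      then show ?case
        by (simp only: union.IH suminf_zero)
    qed
  qed
  then have "AE x in lborel. \<forall>n. indicator (?B n) x *\<^sub>R u x = 0"
    by (subst AE_all_countable) blast
  then show ?thesis
  proof eventually_elim
    case (elim x)
    have "x \<in> (\<Union>n. ?B n)"
      unfolding UN_box_eq_UNIV by simp
    then obtain n where "x \<in> ?B n"
      by blast
    with elim show ?case
      by (metis indicator_simps(1) scaleR_one)
  qed
qed

text \<open>
  The functions \<open>H n\<close> are the inversion integrals damped with \<open>s = 1 / (n + 1)\<close>. Their integrals over a
  box have two limits, one by removing the damping and one by shrinking the Gaussian average.
\<close>

theorem fourier_inversion:
  fixes g :: "'a::euclidean_space \<Rightarrow> complex"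
  assumes g: "integrable lborel g" and ghat: "integrable lborel (fourier g)"
  shows "AE x in lborel. (LINT \<omega>|lborel. iexp (- (\<omega> \<bullet> x)) * fourier g \<omega>) = (2 * pi) ^ DIM('a) * g x"
proof -
  have [measurable]: "g \<in> borel_measurable borel"
    using g by (auto dest: borel_measurable_integrable)
  define L where "L = (LINT \<omega>|lborel. cmod (fourier g \<omega>))"
  define h where "h x = (LINT \<omega>|lborel. iexp (- (\<omega> \<bullet> x)) * fourier g \<omega>)" for x
  define H where "H n x = (LINT \<omega>|lborel. iexp (- (\<omega> \<bullet> x)) *
      (complex_of_real (exp (- (norm (inverse (real (Suc n)) *\<^sub>R \<omega>))\<^sup>2 / 2)) * fourier g \<omega>))" for n x
  have [measurable]: "h \<in> borel_measurable borel" "H n \<in> borel_measurable borel" for n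
    unfolding h_def[abs_def] H_def[abs_def] by measurable
  have h_le: "cmod (h x) \<le> L" for x
    unfolding h_def L_def by (rule order_trans[OF integral_norm_bound]) (simp add: norm_mult)
  have H_bound: "cmod (iexp (- (\<omega> \<bullet> x)) * (complex_of_real (exp (- (norm (inverse (real (Suc n)) *\<^sub>R \<omega>))\<^sup>2 / 2)) * fourier g \<omega>))
      \<le> cmod (fourier g \<omega>)" for \<omega> x n
    by (simp add: norm_mult mult_left_le_one_le)
  have H_le: "cmod (H n x) \<le> L" for n x
    unfolding H_def L_def
    by (rule order_trans[OF integral_norm_bound], rule integral_mono)
      (use H_bound ghat in \<open>auto intro!: Bochner_Integration.integrable_bound[OF ghat]\<close>)
  have H_lim: "(\<lambda>n. H n x) \<longlonglongrightarrow> h x" for x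
    unfolding H_def h_def
  proof (rule integral_dominated_convergence[where w="\<lambda>\<omega>. cmod (fourier g \<omega>)"])
    show "AE \<omega> in lborel. (\<lambda>n. iexp (- (\<omega> \<bullet> x)) *
      (complex_of_real (exp (- (norm (inverse (real (Suc n)) *\<^sub>R \<omega>))\<^sup>2 / 2)) * fourier g \<omega>)) \<longlonglongrightarrow>
      iexp (- (\<omega> \<bullet> x)) * fourier g \<omega>"
    proof (rule AE_I2)
      fix \<omega> :: 'a
      have "(\<lambda>n. complex_of_real (exp (- (norm (inverse (real (Suc n)) *\<^sub>R \<omega>))\<^sup>2 / 2))) \<longlonglongrightarrow>
          complex_of_real (exp (- (norm (0 *\<^sub>R \<omega>))\<^sup>2 / 2))"
        by (intro tendsto_intros LIMSEQ_inverse_real_of_nat) auto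
      then show "(\<lambda>n. iexp (- (\<omega> \<bullet> x)) *
          (complex_of_real (exp (- (norm (inverse (real (Suc n)) *\<^sub>R \<omega>))\<^sup>2 / 2)) * fourier g \<omega>)) \<longlonglongrightarrow>
          iexp (- (\<omega> \<bullet> x)) * fourier g \<omega>"
        by (intro tendsto_mult_left) (use tendsto_mult_right in fastforce)
    qed
  qed (use ghat H_bound in auto)
  have box_int: "integrable lborel (\<lambda>x. indicator (box a b) x *\<^sub>R L)" for a b :: 'a
    using emeasure_lborel_box_finite[of a b] by (intro integrable_scaleR_left integrable_real_indicator) simp_all
  \<comment> \<open>Boundedness of \<open>h\<close> gives integrability on boxes only; on the whole space it is a consequence of the formula.\<close>
  have h_int: "set_integrable lborel (box a b) h" for a b
    unfolding set_integrable_def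
    by (rule Bochner_Integration.integrable_bound[OF box_int[of a b]])
      (use h_le in \<open>auto split: split_indicator intro: order_trans[OF _ abs_ge_self]\<close>)
  have box_eq: "(LINT x:box a b|lborel. h x) = (2 * pi) ^ DIM('a) * (LINT x:box a b|lborel. g x)" for a b
  proof (rule LIMSEQ_unique)
    show "(\<lambda>n. LINT x:box a b|lborel. H n x) \<longlonglongrightarrow> (LINT x:box a b|lborel. h x)"
      unfolding set_lebesgue_integral_def
    proof (rule integral_dominated_convergence[where w="\<lambda>x. indicator (box a b) x *\<^sub>R L"])
      show "AE x in lborel. (\<lambda>n. indicator (box a b) x *\<^sub>R H n x) \<longlonglongrightarrow> indicator (box a b) x *\<^sub>R h x"
        using H_lim by (intro AE_I2 tendsto_intros)
    qed (use box_int H_le in \<open>auto split: split_indicator\<close>)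
    have "H n x = (2 * pi) ^ DIM('a) * (LINT z|lborel. complex_of_real (gauss z) * g (x + inverse (real (Suc n)) *\<^sub>R z))" for n x
      unfolding H_def by (rule gauss_regularised_inversion[OF g]) simp
    then show "(\<lambda>n. LINT x:box a b|lborel. H n x) \<longlonglongrightarrow> (2 * pi) ^ DIM('a) * (LINT x:box a b|lborel. g x)"
      by (simp only: set_integral_mult_right)
        (intro tendsto_mult_left gauss_average_tendsto g LIMSEQ_inverse_real_of_nat negligible_convex_frontier convex_box, auto)
  qed
  have g_int: "set_integrable lborel (box a b) (\<lambda>x. (2 * pi) ^ DIM('a) * g x)" for a b
    unfolding set_integrable_def using g by (intro integrable_mult_indicator) auto
  have "AE x in lborel. h x - (2 * pi) ^ DIM('a) * g x = 0"
  proof (rule AE_eq_0_if_box_integrals_eq_0)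
    show "set_integrable lborel (box a b) (\<lambda>x. h x - (2 * pi) ^ DIM('a) * g x)" for a b
      by (intro set_integral_diff h_int g_int)
    show "(LINT x:box a b|lborel. h x - (2 * pi) ^ DIM('a) * g x) = 0" for a b
      by (subst set_integral_diff(2)[OF h_int g_int]) (simp add: box_eq)
  qed
  then show ?thesis
    by (simp add: h_def)
qed

section \<open>The quadratic-phase transform as a Fourier transform\<close>

text \<open>
  The part of a quadratic phase that depends on one of the two variables only; as the exponent of a
  unimodular factor it does not affect absolute integrability.
\<close>

definition chirp :: "('n::finite \<Rightarrow> real) \<Rightarrow> ('n \<Rightarrow> real) \<Rightarrow> real ^ 'n \<Rightarrow> real" where
  "chirp p q x = (\<Sum>k\<in>UNIV. p k * (x $ k)\<^sup>2 + q k * x $ k)"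

lemma chirp_measurable [measurable]: "chirp p q \<in> borel_measurable borel"
  unfolding chirp_def[abs_def] by measurable

definition qpft_const :: "('n::finite \<Rightarrow> qpft_param) \<Rightarrow> complex" where
  "qpft_const \<Lambda> = (\<Prod>k\<in>UNIV. csqrt (complex_of_real (par_b (\<Lambda> k)) / (2 * complex_of_real pi * \<i>)))"

definition qpft_neg_const :: "('n::finite \<Rightarrow> qpft_param) \<Rightarrow> complex" where
  "qpft_neg_const \<Lambda> = (\<Prod>k\<in>UNIV. csqrt (complex_of_real (par_b (\<Lambda> k)) * \<i> / (2 * complex_of_real pi)))"

lemma csqrt_mult_csqrt_cnj:
  assumes "z \<notin> \<real>\<^sub>\<le>\<^sub>0"
  shows "csqrt z * csqrt (cnj z) = complex_of_real (cmod z)"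
proof -
  have "csqrt (cnj z) = cnj (csqrt z)"
    using assms by (simp add: cnj_csqrt)
  then have "csqrt z * csqrt (cnj z) = complex_of_real ((cmod (csqrt z))\<^sup>2)"
    by (simp only: complex_norm_square)
  also have "(cmod (csqrt z))\<^sup>2 = cmod z"
    by simp
  finally show ?thesis .
qed

text \<open>
  The arguments \<open>b / (2 \<pi> i)\<close> and \<open>b i / (2 \<pi>)\<close> are conjugate and lie off the branch cut, so the product
  of their principal roots is the common modulus \<open>\<bar>b\<bar> / (2 \<pi>)\<close>, whatever the sign of \<open>b\<close>.
\<close>

lemma qpft_const_mult_neg_const:
  fixes \<Lambda> :: "'n::finite \<Rightarrow> qpft_param"
  assumes "\<And>k. par_b (\<Lambda> k) \<noteq> 0"
  shows "qpft_const \<Lambda> * qpft_neg_const \<Lambda> * (2 * pi) ^ CARD('n) = complex_of_real (\<Prod>k\<in>UNIV. \<bar>par_b (\<Lambda> k)\<bar>)"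
proof -
  have "csqrt (complex_of_real b / (2 * complex_of_real pi * \<i>)) * csqrt (complex_of_real b * \<i> / (2 * complex_of_real pi))
      = complex_of_real (\<bar>b\<bar> / (2 * pi))" if "b \<noteq> 0" for b :: real
  proof -
    define z where "z = Complex 0 (- b / (2 * pi))"
    have "complex_of_real b / (2 * complex_of_real pi * \<i>) = z" "complex_of_real b * \<i> / (2 * complex_of_real pi) = cnj z"
      by (simp_all add: z_def complex_eq_iff Re_divide Im_divide power2_eq_square)
    moreover have "cmod z = \<bar>b\<bar> / (2 * pi)"
      by (simp add: z_def cmod_def)
    ultimately show ?thesis
      using csqrt_mult_csqrt_cnj[of z] that by (simp add: z_def complex_nonpos_Reals_iff)
  qed
  then have "qpft_const \<Lambda> * qpft_neg_const \<Lambda> = (\<Prod>k\<in>UNIV. complex_of_real (\<bar>par_b (\<Lambda> k)\<bar> / (2 * pi)))"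
    unfolding qpft_const_def qpft_neg_const_def prod.distrib[symmetric] using assms by simp
  then show ?thesis
    by (simp add: prod_dividef)
qed

lemma sum_qpft_phase:
  fixes \<Lambda> :: "'n::finite \<Rightarrow> qpft_param"
  shows "(\<Sum>k\<in>UNIV. qpft_phase (\<Lambda> k) (\<omega> $ k) (x $ k)) =
    chirp (\<lambda>k. par_a (\<Lambda> k)) (\<lambda>k. par_d (\<Lambda> k)) x + chirp (\<lambda>k. par_c (\<Lambda> k)) (\<lambda>k. par_e (\<Lambda> k)) \<omega> +
    (\<chi> k. par_b (\<Lambda> k) * \<omega> $ k) \<bullet> x"
  by (simp add: chirp_def qpft_phase_def inner_vec_def sum.distrib algebra_simps)

lemma qpft_kernel_eq:
  "qpft_kernel \<Lambda> \<omega> x = qpft_const \<Lambda> *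
    iexp (chirp (\<lambda>k. par_a (\<Lambda> k)) (\<lambda>k. par_d (\<Lambda> k)) x + chirp (\<lambda>k. par_c (\<Lambda> k)) (\<lambda>k. par_e (\<Lambda> k)) \<omega> +
      (\<chi> k. par_b (\<Lambda> k) * \<omega> $ k) \<bullet> x)"
  unfolding sum_qpft_phase[symmetric] qpft_kernel_def qpft_const_def
  by (simp add: prod.distrib exp_sum sum_distrib_left)

lemma qpft_neg_kernel_eq:
  "qpft_neg_kernel \<Lambda> \<omega> x = qpft_neg_const \<Lambda> *
    iexp (- (chirp (\<lambda>k. par_a (\<Lambda> k)) (\<lambda>k. par_d (\<Lambda> k)) x + chirp (\<lambda>k. par_c (\<Lambda> k)) (\<lambda>k. par_e (\<Lambda> k)) \<omega> +
      (\<chi> k. par_b (\<Lambda> k) * \<omega> $ k) \<bullet> x))"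
  unfolding sum_qpft_phase[symmetric] qpft_neg_kernel_def qpft_neg_const_def
  by (simp add: prod.distrib exp_sum sum_distrib_left sum_negf[symmetric] del: sum_negf)

lemma qpft_eq_fourier:
  fixes \<Lambda> :: "'n::finite \<Rightarrow> qpft_param"
  assumes f: "f \<in> borel_measurable lebesgue" and f'[measurable]: "f' \<in> borel_measurable borel"
    and ae: "AE x in lborel. f x = f' x"
  shows "qpft \<Lambda> f \<omega> = qpft_const \<Lambda> * iexp (chirp (\<lambda>k. par_c (\<Lambda> k)) (\<lambda>k. par_e (\<Lambda> k)) \<omega>) *
    fourier (\<lambda>x. iexp (chirp (\<lambda>k. par_a (\<Lambda> k)) (\<lambda>k. par_d (\<Lambda> k)) x) * f' x) (\<chi> k. par_b (\<Lambda> k) * \<omega> $ k)"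
proof -
  have [measurable]: "qpft_kernel \<Lambda> \<omega> \<in> borel_measurable borel"
    unfolding qpft_kernel_eq[abs_def] by measurable
  have "qpft \<Lambda> f \<omega> = (LINT x|lebesgue. qpft_kernel \<Lambda> \<omega> x * f' x)"
    unfolding qpft_def
  proof (rule integral_cong_AE)
    show "AE x in lebesgue. qpft_kernel \<Lambda> \<omega> x * f x = qpft_kernel \<Lambda> \<omega> x * f' x"
      unfolding AE_completion_iff using ae by eventually_elim simp
  qed (intro borel_measurable_times f measurable_completion; simp)+
  also have "\<dots> = (LINT x|lborel. qpft_kernel \<Lambda> \<omega> x * f' x)"
    by (intro integral_completion) measurable
  also have "\<dots> = (LINT x|lborel. (qpft_const \<Lambda> * iexp (chirp (\<lambda>k. par_c (\<Lambda> k)) (\<lambda>k. par_e (\<Lambda> k)) \<omega>)) *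
      (iexp ((\<chi> k. par_b (\<Lambda> k) * \<omega> $ k) \<bullet> x) * (iexp (chirp (\<lambda>k. par_a (\<Lambda> k)) (\<lambda>k. par_d (\<Lambda> k)) x) * f' x)))"
    by (intro Bochner_Integration.integral_cong) (simp_all add: qpft_kernel_eq distrib_left exp_add mult_ac)
  finally show ?thesis
    by (simp only: fourier_def integral_mult_right_zero)
qed

section \<open>Inversion of the quadratic-phase transform\<close>

text \<open>
  Fubini's theorem requires measurability with respect to the product of the Borel algebras, so a
  Lebesgue measurable function is first replaced by a Borel representative.
\<close>

lemma completion_ex_borel_measurable_complex:
  fixes f :: "'a \<Rightarrow> complex"
  assumes "f \<in> borel_measurable (completion M)"
  shows "\<exists>f'\<in>borel_measurable M. AE x in M. f x = f' x"
proof -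
  obtain u where [measurable]: "u \<in> borel_measurable M" and u: "AE x in M. Re (f x) = u x"
    using completion_ex_borel_measurable_real[of "\<lambda>x. Re (f x)" M] assms by auto
  obtain v where [measurable]: "v \<in> borel_measurable M" and v: "AE x in M. Im (f x) = v x"
    using completion_ex_borel_measurable_real[of "\<lambda>x. Im (f x)" M] assms by auto
  have "AE x in M. f x = complex_of_real (u x) + \<i> * complex_of_real (v x)"
    using u v by eventually_elim (simp add: complex_eq_iff)
  then show ?thesis
    by (intro bexI) auto
qed

text \<open>
  Both almost-everywhere identities are the same inversion formula; they differ in the order of the
  factors under the integral. The exceptional set is the union of the one from Fourier inversion and the
  one on which \<open>f\<close> differs from its Borel representative.
\<close>

theorem theorem4p4:
  fixes \<Lambda> :: "'n::finite \<Rightarrow> qpft_param"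
    and f :: "real ^ 'n \<Rightarrow> complex"
  assumes "\<And>k. par_b (\<Lambda> k) \<noteq> 0"
    and "integrable lebesgue f"
    and "integrable lebesgue (qpft \<Lambda> f)"
  shows "(AE x in lebesgue. f x = (LINT t|lebesgue. qpft \<Lambda> f t * qpft_neg_kernel \<Lambda> t x)) \<and>
         (AE x in lebesgue. (qpft_neg \<Lambda> \<circ> qpft \<Lambda>) f x = f x)"
proof -
  have f: "f \<in> borel_measurable lebesgue"
    using assms(2) by (rule borel_measurable_integrable)
  obtain f' where "f' \<in> borel_measurable lborel" and ae: "AE x in lborel. f x = f' x"
    using completion_ex_borel_measurable_complex[OF f] by blast
  then have f'[measurable]: "f' \<in> borel_measurable borel"
    by simp
  have "integrable lebesgue f'"
    using assms(2) ae f measurable_completion[of f' lborel borel] f'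
    by (subst integrable_cong_AE[where g=f]) (auto simp: AE_completion_iff)
  then have f'_int: "integrable lborel f'"
    by (simp add: integrable_completion)
  define p where "p = chirp (\<lambda>k. par_a (\<Lambda> k)) (\<lambda>k. par_d (\<Lambda> k))"
  define q where "q = chirp (\<lambda>k. par_c (\<Lambda> k)) (\<lambda>k. par_e (\<Lambda> k))"
  define D where "D \<omega> = (\<chi> k. par_b (\<Lambda> k) * \<omega> $ k)" for \<omega>
  define g where "g x = iexp (p x) * f' x" for x
  have [measurable]: "p \<in> borel_measurable borel" "q \<in> borel_measurable borel" "D \<in> borel_measurable borel"
    unfolding p_def q_def D_def[abs_def] by measurable
  have [measurable]: "g \<in> borel_measurable borel"
    unfolding g_def[abs_def] by measurable
  have g_int: "integrable lborel g"
    by (rule Bochner_Integration.integrable_bound[OF f'_int]) (auto simp: g_def norm_mult)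
  have Q: "qpft \<Lambda> f \<omega> = qpft_const \<Lambda> * iexp (q \<omega>) * fourier g (D \<omega>)" for \<omega>
    unfolding p_def q_def D_def g_def[abs_def] by (rule qpft_eq_fourier[OF f f' ae])
  have const_prod: "qpft_const \<Lambda> * qpft_neg_const \<Lambda> * (2 * pi) ^ CARD('n) = complex_of_real (\<Prod>k\<in>UNIV. \<bar>par_b (\<Lambda> k)\<bar>)"
    by (rule qpft_const_mult_neg_const) (rule assms(1))
  have prod_nz: "(\<Prod>k\<in>UNIV. \<bar>par_b (\<Lambda> k)\<bar>) \<noteq> 0"
    using assms(1) by simp
  then have C_nz: "qpft_const \<Lambda> \<noteq> 0"
    using const_prod by (metis mult_zero_left of_real_eq_0_iff)
  have Q_meas [measurable]: "qpft \<Lambda> f \<in> borel_measurable borel"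
    unfolding Q[abs_def] by measurable
  have Q_int: "integrable lborel (qpft \<Lambda> f)"
    using assms(3) by (simp add: integrable_completion)
  have "integrable lborel (\<lambda>\<omega>. qpft \<Lambda> f \<omega> / qpft_const \<Lambda>)"
    using Q_int by simp
  \<comment> \<open>Dividing by the constant leaves a function of the same modulus as the one claimed to be integrable.\<close>
  then have "integrable lborel (\<lambda>\<omega>. fourier g (D \<omega>))"
    by (rule Bochner_Integration.integrable_bound) (use C_nz in \<open>auto simp: Q norm_mult norm_divide\<close>)
  then have ghat_int: "integrable lborel (fourier g)"
    unfolding D_def by (subst (asm) lborel_diagonal_vec(1)) (use assms(1) in auto)
  have eq: "(LINT t|lebesgue. qpft \<Lambda> f t * qpft_neg_kernel \<Lambda> t x) = f' x"
    if inv: "(LINT \<omega>|lborel. iexp (- (\<omega> \<bullet> x)) * fourier g \<omega>) = (2 * pi) ^ DIM(real ^ 'n) * g x" for x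
  proof -
    have K: "qpft_neg_kernel \<Lambda> t x = qpft_neg_const \<Lambda> * iexp (- (p x + q t + D t \<bullet> x))" for t
      unfolding p_def q_def D_def by (rule qpft_neg_kernel_eq)
    have "(LINT t|lebesgue. qpft \<Lambda> f t * qpft_neg_kernel \<Lambda> t x) = (LINT t|lborel. qpft \<Lambda> f t * qpft_neg_kernel \<Lambda> t x)"
      by (intro integral_completion) (simp add: K)
    also have "\<dots> = (LINT t|lborel. (qpft_const \<Lambda> * qpft_neg_const \<Lambda> * iexp (- p x)) * (iexp (- (D t \<bullet> x)) * fourier g (D t)))"
    proof (rule Bochner_Integration.integral_cong)
      fix t
      have "iexp (q t) * iexp (- (p x + q t + D t \<bullet> x)) = iexp (- p x) * iexp (- (D t \<bullet> x))"
        unfolding mult_exp_exp by (simp add: algebra_simps)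
      moreover have "qpft \<Lambda> f t * qpft_neg_kernel \<Lambda> t x =
          qpft_const \<Lambda> * qpft_neg_const \<Lambda> * (iexp (q t) * iexp (- (p x + q t + D t \<bullet> x))) * fourier g (D t)"
        unfolding Q K by (simp only: mult_ac)
      ultimately show "qpft \<Lambda> f t * qpft_neg_kernel \<Lambda> t x =
          (qpft_const \<Lambda> * qpft_neg_const \<Lambda> * iexp (- p x)) * (iexp (- (D t \<bullet> x)) * fourier g (D t))"
        by (simp only: mult.assoc)
    qed simp
    also have "\<dots> = (qpft_const \<Lambda> * qpft_neg_const \<Lambda> * iexp (- p x)) * (LINT t|lborel. iexp (- (D t \<bullet> x)) * fourier g (D t))"
      by (rule integral_mult_right_zero)
    finally have 1: "(LINT t|lebesgue. qpft \<Lambda> f t * qpft_neg_kernel \<Lambda> t x) = \<dots>" .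
    have "(\<Prod>k\<in>UNIV. \<bar>par_b (\<Lambda> k)\<bar>) *\<^sub>R (LINT t|lborel. iexp (- (D t \<bullet> x)) * fourier g (D t)) =
        (LINT \<omega>|lborel. iexp (- (\<omega> \<bullet> x)) * fourier g \<omega>)"
      unfolding D_def by (rule lborel_diagonal_vec(2)[symmetric]) (use assms(1) in auto)
    then have "complex_of_real (\<Prod>k\<in>UNIV. \<bar>par_b (\<Lambda> k)\<bar>) * (LINT t|lborel. iexp (- (D t \<bullet> x)) * fourier g (D t)) =
        (2 * pi) ^ CARD('n) * g x"
      using inv by (simp add: scaleR_conv_of_real)
    then have 2: "(qpft_const \<Lambda> * qpft_neg_const \<Lambda>) * (LINT t|lborel. iexp (- (D t \<bullet> x)) * fourier g (D t)) = g x"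
      unfolding const_prod[symmetric] by (simp add: mult.assoc)
    have "(LINT t|lebesgue. qpft \<Lambda> f t * qpft_neg_kernel \<Lambda> t x) = iexp (- p x) * g x"
      unfolding 1 2[symmetric] by (simp only: mult_ac)
    also have "\<dots> = f' x"
      by (simp add: g_def mult.assoc[symmetric] mult_exp_exp)
    finally show ?thesis .
  qed
  have "AE x in lborel. (LINT t|lebesgue. qpft \<Lambda> f t * qpft_neg_kernel \<Lambda> t x) = f x"
    using fourier_inversion[OF g_int ghat_int] ae
    by eventually_elim (simp only: eq)
  then have "AE x in lebesgue. (LINT t|lebesgue. qpft \<Lambda> f t * qpft_neg_kernel \<Lambda> t x) = f x"
    by (rule AE_completion)
  then show ?thesis
    by (simp add: qpft_neg_def mult.commute eq_commute)
qed

end
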